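(* Let $N\ge 1$. Every diagonal unitary acting on $N$ qutrits (i.e. every unitary on $(\mathbb{C}^3)^{\otimes N}$ that is diagonal in the computational basis) can be implemented exactly, as a product of $\mathrm{CX}$ gates and single-qutrit gates, using at most $(3^N-3)/2$ $\mathrm{CX}$ gates (where $\mathrm{CX}$ and $\mathrm{CX}^2$ each count as one $\mathrm{CX}$ gate, and the number of single-qutrit gates is not restricted).
   Context: A qutrit has Hilbert space $\mathbb{C}^3$ with orthonormal computational basis $|0\rangle,|1\rangle,|2\rangle$; $N$ qutrits have Hilbert space $(\mathbb{C}^3)^{\otimes N}$ with computational basis the tensor products of these vectors. The two-qutrit gate $\mathrm{CX}$ with control qutrit $a$ and target qutrit $b$ ($a\ne b$), written $\mathrm{CX}_{a,b}$, acts on computational basis states by $|x\rangle_a|y\rangle_b\mapsto|x\rangle_a|(x+y)\bmod 3\rangle_b$ and as the identity on the other qutrits. It satisfies $\mathrm{CX}^3=\mathbb{1}$, so $\mathrm{CX}^2=\mathrm{CX}^\dagger$. Counting convention: a nontrivial power $\mathrm{CX}_{a,b}^m$, $m\in\{1,2\}$, counts as one $\mathrm{CX}$ gate. Any ordered pair of distinct qutrits may be used, and no ancilla qutrits are used. A single-qutrit gate is a unitary operator on $\mathbb{C}^3$ acting on one of the qutrits and as the identity on the others. *)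

theory Defs
  imports Complex_Main "Jordan_Normal_Form.Matrix" "Jordan_Normal_Form.Schur_Decomposition"
begin

text \<open>
  The space of \<open>N\<close> qutrits is identified with the complex vectors of dimension \<open>3 ^ N\<close>: the
  computational basis state with qutrit \<open>k\<close> in state \<open>x\<^sub>k\<close> (for \<open>k < N\<close>) is the standard basis vector
  with index \<open>\<Sum>k<N. x\<^sub>k * 3 ^ k\<close>.  Operators are matrices with rows indexed by the output state.
\<close>

definition trit :: "nat \<Rightarrow> nat \<Rightarrow> nat" where
  "trit i k = i div 3 ^ k mod 3"

definition unitary_mat :: "nat \<Rightarrow> complex mat \<Rightarrow> bool" where
  "unitary_mat n A \<longleftrightarrow>
     A \<in> carrier_mat n n \<and> mat_adjoint A * A = 1\<^sub>m n \<and> A * mat_adjoint A = 1\<^sub>m n"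

definition cx_mat :: "nat \<Rightarrow> nat \<Rightarrow> nat \<Rightarrow> complex mat" where
  "cx_mat N a b = mat (3 ^ N) (3 ^ N) (\<lambda>(i, j).
     if trit i b = (trit j a + trit j b) mod 3 \<and> (\<forall>k<N. k \<noteq> b \<longrightarrow> trit i k = trit j k)
     then 1 else 0)"

text \<open>The tensor product of \<open>U\<close> on qutrit \<open>a\<close> with the identity on all other qutrits.\<close>

definition local_mat :: "nat \<Rightarrow> nat \<Rightarrow> complex mat \<Rightarrow> complex mat" where
  "local_mat N a U = mat (3 ^ N) (3 ^ N) (\<lambda>(i, j).
     if \<forall>k<N. k \<noteq> a \<longrightarrow> trit i k = trit j k then U $$ (trit i a, trit j a) else 0)"

text \<open>\<open>CX a b m\<close> is the \<open>m\<close>-th power of the gate with control \<open>a\<close> and target \<open>b\<close>.\<close>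

datatype gate = CX nat nat nat | Local nat "complex mat"

fun valid_gate :: "nat \<Rightarrow> gate \<Rightarrow> bool" where
  "valid_gate N (CX a b m) \<longleftrightarrow> a < N \<and> b < N \<and> a \<noteq> b \<and> m \<in> {1, 2}"
| "valid_gate N (Local a U) \<longleftrightarrow> a < N \<and> unitary_mat 3 U"

fun gate_mat :: "nat \<Rightarrow> gate \<Rightarrow> complex mat" where
  "gate_mat N (CX a b m) = cx_mat N a b ^\<^sub>m m"
| "gate_mat N (Local a U) = local_mat N a U"

fun is_CX :: "gate \<Rightarrow> bool" where
  "is_CX (CX a b m) \<longleftrightarrow> True"
| "is_CX (Local a U) \<longleftrightarrow> False"

fun circuit_mat :: "nat \<Rightarrow> gate list \<Rightarrow> complex mat" where
  "circuit_mat N [] = 1\<^sub>m (3 ^ N)"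
| "circuit_mat N (g # gs) = gate_mat N g * circuit_mat N gs"

definition cx_count :: "gate list \<Rightarrow> nat" where
  "cx_count gs = length (filter is_CX gs)"

end

theory Submission
  imports Defs
begin

text \<open>
  One qutrit \<open>b\<close> at a time is used as a target.  A phase function \<open>f(x, y)\<close> of \<open>n\<close> control trits \<open>x\<close>
  and the target trit \<open>y\<close> is written, up to a function of \<open>x\<close> alone, as a sum of functions of
  \<open>y + l \<bullet> x\<close>, where \<open>l\<close> runs through the \<open>3 ^ n\<close> coefficient vectors modulo 3.  Walking through these
  vectors along a cyclic modular Gray code costs one CX per step, hence \<open>3 ^ n\<close> gates in all; the
  remaining function of \<open>x\<close> is handled recursively, and \<open>3 + 3\<^sup>2 + \<dots> + 3 ^ (N - 1) = (3 ^ N - 3) / 2\<close>.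
  The Gray code and the decomposition of \<open>f\<close> are built together by induction on \<open>n\<close>: the code for
  \<open>n + 1\<close> trits is three copies of the one for \<open>n\<close> trits, separated by a CX controlled by the new
  trit, and the decomposition over the new trit is an inverse Radon transform on \<open>\<int>\<^sub>3\<^sup>2\<close>.
\<close>

section \<open>Trit strings and basis indices\<close>

text \<open>Strings are total functions padded with zeros, so that agreement on the first
  \<open>N\<close> trits is plain equality of functions.\<close>

definition trit_strings :: "nat \<Rightarrow> (nat \<Rightarrow> nat) set" where
  "trit_strings N = {x. (\<forall>k. x k < 3) \<and> (\<forall>k\<ge>N. x k = 0)}"

definition index_of :: "nat \<Rightarrow> (nat \<Rightarrow> nat) \<Rightarrow> nat" where
  "index_of N x = (\<Sum>k<N. x k * 3 ^ k)"

lemma trit_less: "trit i k < 3"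
  by (simp add: trit_def)

lemma trit_in_trit_strings:
  assumes "i < 3 ^ N"
  shows "trit i \<in> trit_strings N"
proof -
  have "trit i k = 0" if "k \<ge> N" for k
  proof -
    have "(3::nat) ^ N \<le> 3 ^ k" using that by (intro power_increasing) auto
    then have "i < 3 ^ k" using assms by linarith
    then show ?thesis by (simp add: trit_def)
  qed
  then show ?thesis by (auto simp: trit_strings_def trit_less)
qed

lemma index_of_less:
  assumes "\<And>k. x k < 3"
  shows "index_of N x < 3 ^ N"
proof (induction N)
  case 0
  then show ?case by (simp add: index_of_def)
next
  case (Suc N)
  have "x N * 3 ^ N \<le> 2 * 3 ^ N" using assms[of N] by (intro mult_right_mono) auto
  moreover have "index_of (Suc N) x = index_of N x + x N * 3 ^ N" by (simp add: index_of_def)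
  ultimately have "index_of (Suc N) x < 3 ^ N + 2 * 3 ^ N" using Suc by linarith
  then show ?case by simp
qed

lemma index_of_trit: "index_of N (trit i) = i mod 3 ^ N"
proof (induction N)
  case (Suc N)
  have "i mod 3 ^ Suc N = 3 ^ N * (i div 3 ^ N mod 3) + i mod 3 ^ N"
    using mod_mult2_eq[of i "3 ^ N" 3] by (simp add: mult.commute)
  then show ?case using Suc by (simp add: index_of_def trit_def)
qed (simp add: index_of_def)

lemma trit_index_of_below:
  assumes "\<And>k. x k < 3" and "k < N"
  shows "trit (index_of N x) k = x k"
  using assms(2)
proof (induction N)
  case (Suc N)
  have eq: "index_of (Suc N) x = index_of N x + x N * 3 ^ N" by (simp add: index_of_def)
  show ?case
  proof (cases "k = N")
    case True
    then show ?thesis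
      using index_of_less[OF assms(1), of N] assms(1)[of N] by (simp add: trit_def eq)
  next
    case False
    with Suc.prems have "k < N" by simp
    then obtain m where m: "N = k + Suc m" using less_iff_Suc_add by auto
    \<comment> \<open>The new leading digit contributes a multiple of \<open>3 * 3 ^ k\<close>, so
      the quotient by \<open>3 ^ k\<close> changes only by a multiple of 3.\<close>
    have "x N * 3 ^ N = (3 * (x N * 3 ^ m)) * 3 ^ k" by (simp add: m power_add)
    then have "index_of (Suc N) x div 3 ^ k = 3 * (x N * 3 ^ m) + index_of N x div 3 ^ k"
      unfolding eq by (simp only:) (rule div_mult_self1, simp)
    then show ?thesis using Suc.IH[OF \<open>k < N\<close>] by (simp add: trit_def)
  qed
qed simp

lemma trit_index_of:
  assumes "x \<in> trit_strings N"
  shows "trit (index_of N x) = x"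
proof
  fix k
  have x: "\<And>k. x k < 3" using assms by (simp add: trit_strings_def)
  show "trit (index_of N x) k = x k"
  proof (cases "k < N")
    case True
    then show ?thesis by (rule trit_index_of_below[OF x])
  next
    case False
    have "trit (index_of N x) \<in> trit_strings N"
      by (intro trit_in_trit_strings index_of_less x)
    with False assms show ?thesis by (simp add: trit_strings_def)
  qed
qed

lemma trit_eq_iff:
  assumes "i < 3 ^ N" "x \<in> trit_strings N"
  shows "trit i = x \<longleftrightarrow> i = index_of N x"
  using assms by (metis index_of_trit mod_less trit_index_of)

section \<open>Monomial matrices and the gates as instances\<close>

text \<open>The operator taking the basis state \<open>x\<close> to \<open>h x\<close> times the
  basis state \<open>p x\<close>. All gates used in the construction have this form, so circuits can
  be tracked through \<open>h\<close> and \<open>p\<close> alone.\<close>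

definition monomial_mat ::
    "nat \<Rightarrow> ((nat \<Rightarrow> nat) \<Rightarrow> complex) \<Rightarrow> ((nat \<Rightarrow> nat) \<Rightarrow> nat \<Rightarrow> nat) \<Rightarrow> complex mat" where
  "monomial_mat N h p =
     mat (3 ^ N) (3 ^ N) (\<lambda>(i, j). if trit i = p (trit j) then h (trit j) else 0)"

lemma monomial_mat_cong:
  assumes "\<And>x. x \<in> trit_strings N \<Longrightarrow> h x = h' x" "\<And>x. x \<in> trit_strings N \<Longrightarrow> p x = p' x"
  shows "monomial_mat N h p = monomial_mat N h' p'"
  unfolding monomial_mat_def by (rule cong_mat) (auto simp: assms trit_in_trit_strings)

lemma monomial_mat_mult:
  assumes p: "\<And>x. x \<in> trit_strings N \<Longrightarrow> p x \<in> trit_strings N"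
  shows "monomial_mat N h' p' * monomial_mat N h p
       = monomial_mat N (\<lambda>x. h x * h' (p x)) (\<lambda>x. p' (p x))"
proof (rule eq_matI)
  fix i j
  assume "i < dim_row (monomial_mat N (\<lambda>x. h x * h' (p x)) (\<lambda>x. p' (p x)))"
    and "j < dim_col (monomial_mat N (\<lambda>x. h x * h' (p x)) (\<lambda>x. p' (p x)))"
  then have ij: "i < 3 ^ N" "j < 3 ^ N" by (simp_all add: monomial_mat_def)
  \<comment> \<open>The only intermediate index that contributes to the matrix product.\<close>
  define m where "m = index_of N (p (trit j))"
  have pj: "p (trit j) \<in> trit_strings N" by (intro p trit_in_trit_strings ij)
  then have m: "m < 3 ^ N" "trit m = p (trit j)"
    by (auto simp: m_def trit_index_of trit_strings_def intro: index_of_less)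
  have "(monomial_mat N h' p' * monomial_mat N h p) $$ (i, j)
      = (\<Sum>k = 0..<3 ^ N. (if trit i = p' (trit k) then h' (trit k) else 0)
           * (if trit k = p (trit j) then h (trit j) else 0))"
    using ij by (simp add: monomial_mat_def scalar_prod_def)
  also have "\<dots> = (\<Sum>k = 0..<3 ^ N. if k = m then (if trit i = p' (trit m) then h' (trit m) else 0)
           * h (trit j) else 0)"
    by (rule sum.cong) (auto simp: trit_eq_iff[OF _ pj] m_def)
  also have "\<dots> = (if trit i = p' (trit m) then h' (trit m) else 0) * h (trit j)"
    using m(1) by simp
  finally show "(monomial_mat N h' p' * monomial_mat N h p) $$ (i, j)
      = monomial_mat N (\<lambda>x. h x * h' (p x)) (\<lambda>x. p' (p x)) $$ (i, j)"
    using ij m by (simp add: monomial_mat_def)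
qed (simp_all add: monomial_mat_def)

lemma one_mat_eq_monomial_mat: "1\<^sub>m (3 ^ N) = monomial_mat N (\<lambda>x. 1) (\<lambda>x. x)"
  unfolding monomial_mat_def one_mat_def
  by (rule cong_mat)
     (auto simp: trit_eq_iff[OF _ trit_in_trit_strings] index_of_trit)

lemma cx_mat_eq_monomial_mat:
  assumes "b < N"
  shows "cx_mat N a b = monomial_mat N (\<lambda>x. 1) (\<lambda>x. x(b := (x b + x a) mod 3))"
proof -
  have "(trit i b = (trit j a + trit j b) mod 3 \<and> (\<forall>k<N. k \<noteq> b \<longrightarrow> trit i k = trit j k))
      \<longleftrightarrow> trit i = (trit j)(b := (trit j b + trit j a) mod 3)" (is "?l \<longleftrightarrow> ?r")
    if "i < 3 ^ N" "j < 3 ^ N" for i j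
  proof
    assume ?l
    moreover have "trit i k = trit j k" if "\<not> k < N" for k
      using trit_in_trit_strings[OF \<open>i < 3 ^ N\<close>] trit_in_trit_strings[OF \<open>j < 3 ^ N\<close>] that
      by (simp add: trit_strings_def)
    ultimately show ?r by (auto simp: fun_eq_iff add.commute)
  next
    assume ?r
    then show ?l by (simp add: add.commute)
  qed
  then show ?thesis unfolding cx_mat_def monomial_mat_def by (intro cong_mat) auto
qed

definition phase_mat :: "(nat \<Rightarrow> real) \<Rightarrow> complex mat" where
  "phase_mat u = mat 3 3 (\<lambda>(i, j). if i = j then cis (u i) else 0)"

text \<open>Adjoints negate the angles and products add them, so both unitarity equations reduce to
  the zero angle.\<close>

lemma unitary_phase_mat: "unitary_mat 3 (phase_mat u)"
proof -
  have adj: "mat_adjoint (phase_mat u) = phase_mat (\<lambda>i. - u i)"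
    by (rule eq_matI) (auto simp: phase_mat_def mat_adjoint_def mat_of_rows_def cis_cnj)
  have mult: "phase_mat v * phase_mat w = phase_mat (\<lambda>i. v i + w i)" for v w
  proof (rule eq_matI)
    fix i j
    assume "i < dim_row (phase_mat (\<lambda>i. v i + w i))" "j < dim_col (phase_mat (\<lambda>i. v i + w i))"
    then have ij: "i < 3" "j < 3" by (simp_all add: phase_mat_def)
    then have "(phase_mat v * phase_mat w) $$ (i, j)
        = (\<Sum>k = 0..<3. (if i = k then cis (v i) else 0) * (if k = j then cis (w k) else 0))"
      by (simp add: phase_mat_def scalar_prod_def)
    also have "\<dots> = (\<Sum>k = 0..<3. if k = i then (if i = j then cis (v i) * cis (w i) else 0) else 0)"
      by (rule sum.cong) auto
    also have "\<dots> = phase_mat (\<lambda>i. v i + w i) $$ (i, j)"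
      using ij by (simp add: phase_mat_def cis_mult)
    finally show "(phase_mat v * phase_mat w) $$ (i, j) = phase_mat (\<lambda>i. v i + w i) $$ (i, j)" .
  qed (simp_all add: phase_mat_def)
  have one: "phase_mat (\<lambda>i. 0) = 1\<^sub>m 3"
    by (rule eq_matI) (auto simp: phase_mat_def)
  show ?thesis
    unfolding unitary_mat_def adj mult by (simp add: one) (simp add: phase_mat_def)
qed

lemma local_mat_phase_mat:
  assumes "a < N"
  shows "local_mat N a (phase_mat u) = monomial_mat N (\<lambda>x. cis (u (x a))) (\<lambda>x. x)"
proof -
  have "(\<forall>k<N. k \<noteq> a \<longrightarrow> trit i k = trit j k) \<and> trit i a = trit j a \<longleftrightarrow> trit i = trit j"
    if "i < 3 ^ N" "j < 3 ^ N" for i j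
    using trit_in_trit_strings[OF that(1)] trit_in_trit_strings[OF that(2)]
    by (auto simp: trit_strings_def fun_eq_iff) (metis linorder_not_le)
  then show ?thesis
    unfolding local_mat_def monomial_mat_def
    by (intro cong_mat) (auto simp: phase_mat_def trit_less)
qed

section \<open>Composition of circuits\<close>

text \<open>The closure condition on \<open>p\<close> is carried along because the product rule for
  monomial matrices requires it.\<close>

definition implements ::
    "nat \<Rightarrow> gate list \<Rightarrow> ((nat \<Rightarrow> nat) \<Rightarrow> complex) \<Rightarrow> ((nat \<Rightarrow> nat) \<Rightarrow> nat \<Rightarrow> nat) \<Rightarrow> bool" where
  "implements N gs h p \<longleftrightarrow>
     (\<forall>g\<in>set gs. valid_gate N g) \<and> circuit_mat N gs = monomial_mat N h p \<and>
     (\<forall>x\<in>trit_strings N. p x \<in> trit_strings N)"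

lemma implements_cong:
  assumes "implements N gs h p"
    and "\<And>x. x \<in> trit_strings N \<Longrightarrow> h x = h' x" "\<And>x. x \<in> trit_strings N \<Longrightarrow> p x = p' x"
  shows "implements N gs h' p'"
  using assms monomial_mat_cong[of N h h' p p'] by (simp add: implements_def)

lemma monomial_mat_carrier: "monomial_mat N h p \<in> carrier_mat (3 ^ N) (3 ^ N)"
  by (simp add: monomial_mat_def)

lemma gate_mat_carrier: "gate_mat N g \<in> carrier_mat (3 ^ N) (3 ^ N)"
  by (cases g) (auto simp: cx_mat_def local_mat_def intro!: pow_carrier_mat)

lemma circuit_mat_carrier: "circuit_mat N gs \<in> carrier_mat (3 ^ N) (3 ^ N)"
  by (induction gs) (auto intro: mult_carrier_mat gate_mat_carrier)

lemma circuit_mat_append: "circuit_mat N (gs @ hs) = circuit_mat N gs * circuit_mat N hs"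
proof (induction gs)
  case Nil
  then show ?case using circuit_mat_carrier[of N hs] by simp
next
  case (Cons g gs)
  then show ?case
    using assoc_mult_mat[OF gate_mat_carrier circuit_mat_carrier circuit_mat_carrier] by simp
qed

text \<open>The head of a gate list is applied last, so \<open>gs\<close> acts before \<open>gs'\<close> here.\<close>

lemma implements_append:
  assumes "implements N gs' h' p'" "implements N gs h p"
  shows "implements N (gs' @ gs) (\<lambda>x. h x * h' (p x)) (\<lambda>x. p' (p x))"
  using assms monomial_mat_mult[of N p h' p' h] by (auto simp: implements_def circuit_mat_append)

lemma implements_CX:
  assumes "a < N" "b < N" "a \<noteq> b"
  shows "implements N [CX a b 1] (\<lambda>x. 1) (\<lambda>x. x(b := (x b + x a) mod 3))"
proof -
  have "cx_mat N a b \<in> carrier_mat (3 ^ N) (3 ^ N)" by (simp add: cx_mat_def)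
  then show ?thesis
    using assms by (auto simp: implements_def cx_mat_eq_monomial_mat trit_strings_def)
qed

lemma implements_Local:
  assumes "a < N"
  shows "implements N [Local a (phase_mat u)] (\<lambda>x. cis (u (x a))) (\<lambda>x. x)"
  using assms right_mult_one_mat[OF monomial_mat_carrier]
  by (simp add: implements_def unitary_phase_mat local_mat_phase_mat)

lemma cx_count_append: "cx_count (gs @ hs) = cx_count gs + cx_count hs"
  by (simp add: cx_count_def)

section \<open>Gray-code circuit for one target qutrit\<close>

definition depends_below :: "nat \<Rightarrow> ((nat \<Rightarrow> nat) \<Rightarrow> 'a) \<Rightarrow> bool" where
  "depends_below n f \<longleftrightarrow> (\<forall>x x'. (\<forall>k<n. x k = x' k) \<longrightarrow> f x = f x')"

lemma depends_belowD:
  "depends_below n f \<Longrightarrow> (\<And>k. k < n \<Longrightarrow> x k = x' k) \<Longrightarrow> f x = f x'"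
  by (auto simp: depends_below_def)

lemma depends_below_upd:
  assumes "depends_below n f" "n \<le> b"
  shows "f (x(b := v)) = f x"
  using assms(2) by (intro depends_belowD[OF assms(1)]) auto

text \<open>
  The lines \<open>{(t, y + j * (s - t)) | t}\<close> with slopes \<open>j = 0, 1, 2\<close> through \<open>(s, y)\<close> meet in that point
  and together cover every point of the other columns \<open>t \<noteq> s\<close> once.  Natural subtraction is avoided by writing
  \<open>2\<close> for \<open>- 1\<close>.
\<close>

lemma radon_mod_3:
  fixes F :: "nat \<Rightarrow> nat \<Rightarrow> real"
  assumes "s < 3" "y < 3"
  shows "(\<Sum>j<3. \<Sum>t<3. F t ((y + j * (s + 2 * t)) mod 3)) =
    3 * F s y + (\<Sum>t\<in>{..<3} - {s}. \<Sum>z<3. F t z)"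
proof -
  have three: "{..<3::nat} = {0, 1, 2}" by auto
  have "s = 0 \<or> s = 1 \<or> s = 2" "y = 0 \<or> y = 1 \<or> y = 2" using assms by auto
  then show ?thesis
    unfolding three by (elim disjE) (simp_all add: insert_Diff_if, simp_all add: numeral_2_eq_2)
qed

text \<open>Total shift of the target by the Gray code on \<open>n\<close> trits, before the closing step.\<close>

fun gray_shift :: "nat \<Rightarrow> (nat \<Rightarrow> nat) \<Rightarrow> nat" where
  "gray_shift 0 x = 0"
| "gray_shift (Suc n) x = 2 * x n"

lemma depends_below_gray_shift: "depends_below n (gray_shift n)"
  by (cases n) (auto simp: depends_below_def)

text \<open>The phase \<open>e\<close> involves control trits only and is left to a later recursion.
  Omitting the closing step, hence the \<open>+ 1\<close> and the leftover shift, lets three copies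
  be joined by just two CX gates.\<close>

lemma implements_gray:
  fixes f :: "(nat \<Rightarrow> nat) \<Rightarrow> nat \<Rightarrow> real"
  assumes "n \<le> b" "b < N" "depends_below n f"
  shows "\<exists>gs e. depends_below n e \<and> cx_count gs + 1 = 3 ^ n \<and>
           implements N gs (\<lambda>x. cis (f x (x b) - e x)) (\<lambda>x. x(b := (x b + gray_shift n x) mod 3))"
  using assms(1,3)
proof (induction n arbitrary: f)
  case 0
  \<comment> \<open>Without control trits, \<open>f\<close> is a single function of the target trit:
    one local gate suffices and \<open>e\<close> is zero.\<close>
  have "f x = f (\<lambda>_. 0)" for x using 0(2) by (simp add: depends_below_def)
  then have "f x (x b) = f (\<lambda>_. 0) (x b)" for x by metis
  with implements_Local[OF assms(2), of "f (\<lambda>_. 0)"]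
  have "implements N [Local b (phase_mat (f (\<lambda>_. 0)))]
      (\<lambda>x. cis (f x (x b) - 0)) (\<lambda>x. x(b := (x b + gray_shift 0 x) mod 3))"
    by (elim implements_cong) (auto simp: trit_strings_def)
  then show ?case
    by (intro exI[of _ "[Local b (phase_mat (f (\<lambda>_. 0)))]"] exI[of _ "\<lambda>_. 0"] conjI)
       (simp add: depends_below_def, simp add: cx_count_def, assumption)
next
  case (Suc n)
  let ?d = "gray_shift n"
  note nb = \<open>Suc n \<le> b\<close>
  \<comment> \<open>Block \<open>j\<close> meets the target shifted by
    \<open>j * (?d x + x n)\<close>. Since 2 is -1 modulo 3, the added term turns this into the
    shift \<open>j * (x n - t)\<close> of the line with slope \<open>j\<close>. Summing over
    \<open>t\<close> removes the dependence on trit \<open>n\<close>.\<close>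
  define g where "g j x z = (\<Sum>t<3. f (x(n := t)) ((z + 2 * j * (t + ?d x)) mod 3)) / 3"
    for j :: nat and x z
  have g: "depends_below n (g j)" for j
    unfolding depends_below_def
  proof (intro allI impI ext)
    fix x x' :: "nat \<Rightarrow> nat" and z
    assume eq: "\<forall>k<n. x k = x' k"
    then have "?d x = ?d x'" by (intro depends_belowD[OF depends_below_gray_shift]) auto
    moreover have "f (x(n := t)) = f (x'(n := t))" for t
      using eq by (intro depends_belowD[OF Suc.prems(2)]) (auto simp: less_Suc_eq)
    ultimately show "g j x z = g j x' z" by (simp add: g_def)
  qed
  let ?block = "\<lambda>j gs e. depends_below n e \<and> cx_count gs + 1 = 3 ^ n \<and>
      implements N gs (\<lambda>x. cis (g j x (x b) - e x)) (\<lambda>x. x(b := (x b + ?d x) mod 3))"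
  have "\<forall>j. \<exists>gs e. ?block j gs e"
    using nb by (intro allI Suc.IH g) simp
  from choice[OF this] obtain gs where "\<forall>j. \<exists>e. ?block j (gs j) e"
    by blast
  from choice[OF this] obtain e where block: "\<forall>j. ?block j (gs j) (e j)"
    by blast
  have e: "depends_below n (e j)" for j using block by blast
  have count: "cx_count (gs j) + 1 = 3 ^ n" for j using block by blast
  have gs: "implements N (gs j) (\<lambda>x. cis (g j x (x b) - e j x))
      (\<lambda>x. x(b := (x b + ?d x) mod 3))" for j
    using block by blast
  \<comment> \<open>The columns \<open>t \<noteq> x n\<close> of the Radon identity. They do not
    involve the target trit, so the new correction \<open>e'\<close> can absorb them.\<close>
  define r where "r x = (\<Sum>t\<in>{..<3} - {x n}. \<Sum>z<3. f (x(n := t)) z) / 3" for x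
  define e' where "e' x = e 0 x + e 1 x + e 2 x - r x" for x
  \<comment> \<open>Block 0 acts first; the CX count is
    \<open>3 * (3 ^ n - 1) + 2 = 3 ^ Suc n - 1\<close>.\<close>
  define hs where "hs = gs 2 @ [CX n b 1] @ gs 1 @ [CX n b 1] @ gs 0"
  have r: "depends_below (Suc n) r"
    unfolding depends_below_def
  proof (intro allI impI)
    fix x x' :: "nat \<Rightarrow> nat"
    assume eq: "\<forall>k<Suc n. x k = x' k"
    have "f (x(n := t)) = f (x'(n := t))" for t
      using eq by (intro depends_belowD[OF Suc.prems(2)]) (auto simp: less_Suc_eq)
    then show "r x = r x'" using eq by (simp add: r_def)
  qed
  have e': "depends_below (Suc n) e'"
    unfolding depends_below_def
  proof (intro allI impI)
    fix x x' :: "nat \<Rightarrow> nat"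
    assume eq: "\<forall>k<Suc n. x k = x' k"
    have "e j x = e j x'" for j using eq by (intro depends_belowD[OF e]) auto
    moreover have "r x = r x'" using eq by (intro depends_belowD[OF r]) auto
    ultimately show "e' x = e' x'" by (simp add: e'_def)
  qed
  have decomp: "g 0 x (x b) + g 1 x ((x b + (?d x + x n)) mod 3)
      + g 2 x ((x b + 2 * (?d x + x n)) mod 3) = f x (x b) + r x"
    if x: "x \<in> trit_strings N" for x
  proof -
    have x3: "x n < 3" "x b < 3" using x by (auto simp: trit_strings_def)
    have mod: "((x b + j * (?d x + x n)) mod 3 + 2 * j * (t + ?d x)) mod 3
        = (x b + j * (x n + 2 * t)) mod 3" for j t
    proof -
      have "((x b + j * (?d x + x n)) mod 3 + 2 * j * (t + ?d x)) mod 3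
          = (x b + j * (?d x + x n) + 2 * j * (t + ?d x)) mod 3"
        by (simp add: mod_add_left_eq)
      also have "x b + j * (?d x + x n) + 2 * j * (t + ?d x)
          = x b + j * (x n + 2 * t) + 3 * (j * ?d x)"
        by (simp add: algebra_simps)
      also have "\<dots> mod 3 = (x b + j * (x n + 2 * t)) mod 3" by (rule mod_mult_self2)
      finally show ?thesis .
    qed
    have "(\<Sum>j<3. g j x ((x b + j * (?d x + x n)) mod 3))
        = (\<Sum>j<3. \<Sum>t<3. f (x(n := t)) ((x b + j * (x n + 2 * t)) mod 3)) / 3"
      by (simp only: g_def mod sum_divide_distrib)
    also have "\<dots> = f x (x b) + r x"
      by (simp add: radon_mod_3[OF x3, of "\<lambda>t. f (x(n := t))"] r_def)
    finally have *: "(\<Sum>j<3. g j x ((x b + j * (?d x + x n)) mod 3)) = f x (x b) + r x" .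
    have three: "{..<3::nat} = {0, 1, 2}" by auto
    show ?thesis using * x3 unfolding three by simp
  qed
  have "n \<le> b" and nb': "n \<noteq> b" using nb by auto
  \<comment> \<open>Writing the target leaves every function of the first \<open>n\<close> trits
    unchanged, as \<open>n \<le> b\<close>.\<close>
  note upd = depends_below_upd[OF g \<open>n \<le> b\<close>] depends_below_upd[OF e \<open>n \<le> b\<close>]
    depends_below_upd[OF depends_below_gray_shift \<open>n \<le> b\<close>]
    fun_upd_same fun_upd_other[OF nb'] fun_upd_upd
  have cx: "implements N [CX n b 1] (\<lambda>x. 1) (\<lambda>x. x(b := (x b + x n) mod 3))"
    using nb assms(2) by (intro implements_CX) auto
  \<comment> \<open>Target values at the start of blocks 1 and 2 and at the end. The three shifts by
    \<open>?d x\<close> cancel modulo 3, leaving only the two CX contributions.\<close>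
  have mods: "((x b + ?d x) mod 3 + x n) mod 3 = (x b + (?d x + x n)) mod 3"
    "(((x b + (?d x + x n)) mod 3 + ?d x) mod 3 + x n) mod 3 = (x b + 2 * (?d x + x n)) mod 3"
    "((x b + 2 * (?d x + x n)) mod 3 + ?d x) mod 3 = (x b + 2 * x n) mod 3" for x
    by presburger+
  have "implements N hs (\<lambda>x. cis (f x (x b) - e' x))
      (\<lambda>x. x(b := (x b + gray_shift (Suc n) x) mod 3))"
    unfolding hs_def
  proof (rule implements_cong[OF implements_append[OF gs implements_append[OF cx
        implements_append[OF gs implements_append[OF cx gs]]]]], goal_cases)
    case (1 x)
    have "g 0 x (x b) - e 0 x + (g 1 x ((x b + (?d x + x n)) mod 3) - e 1 x
        + (g 2 x ((x b + 2 * (?d x + x n)) mod 3) - e 2 x)) = f x (x b) - e' x"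
      using decomp[OF 1] by (simp add: e'_def)
    then show ?case by (simp only: upd mods mult_1_left mult_1_right cis_mult add.assoc)
  next
    case (2 x)
    show ?case by (simp only: upd mods gray_shift.simps)
  qed
  moreover have "cx_count hs + 1 = 3 ^ Suc n"
    using count[of 0] count[of 1] count[of 2] by (simp add: hs_def cx_count_append) (simp add: cx_count_def)
  ultimately show ?case using e' by blast
qed

section \<open>Recursion over the target qutrit\<close>

text \<open>The highest trit serves as target and the correction \<open>e\<close> is handled by
  induction. The count closes because \<open>2 * 3 ^ b + 3 ^ b = 3 ^ Suc b\<close>.\<close>

lemma implements_diagonal:
  fixes f :: "(nat \<Rightarrow> nat) \<Rightarrow> real"
  assumes "Suc n \<le> N" "depends_below (Suc n) f"
  shows "\<exists>gs. implements N gs (\<lambda>x. cis (f x)) (\<lambda>x. x) \<and> 2 * cx_count gs + 3 = 3 ^ Suc n"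
  using assms
proof (induction n arbitrary: f)
  case 0
  have "f x = f ((\<lambda>_. 0)(0 := x 0))" for x by (rule depends_belowD[OF 0(2)]) auto
  then have "implements N [Local 0 (phase_mat (\<lambda>v. f ((\<lambda>_. 0)(0 := v))))] (\<lambda>x. cis (f x)) (\<lambda>x. x)"
    using 0(1) by (intro implements_cong[OF implements_Local]) (auto intro!: arg_cong[where f = cis])
  then show ?case by (intro exI conjI, assumption) (simp add: cx_count_def)
next
  case (Suc n)
  let ?b = "Suc n"
  have "depends_below ?b (\<lambda>x y. f (x(?b := y)))"
    unfolding depends_below_def
    by (intro allI impI ext depends_belowD[OF Suc.prems(2)]) (auto simp: less_Suc_eq)
  moreover have "?b < N" using Suc.prems(1) by simp
  ultimately obtain gs e where e: "depends_below ?b e" and count: "cx_count gs + 1 = 3 ^ ?b"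
    and gs: "implements N gs (\<lambda>x. cis (f (x(?b := x ?b)) - e x))
               (\<lambda>x. x(?b := (x ?b + gray_shift ?b x) mod 3))"
    using implements_gray[OF order_refl, of ?b N "\<lambda>x y. f (x(?b := y))"] by blast
  obtain gs' where gs': "implements N gs' (\<lambda>x. cis (e x)) (\<lambda>x. x)"
    and count': "2 * cx_count gs' + 3 = 3 ^ ?b"
    using Suc.IH[OF _ e] Suc.prems(1) by auto
  \<comment> \<open>The closing step: the leftover shift is \<open>2 * x n\<close>, so one more CX
    with control \<open>n\<close> restores the target.\<close>
  have cx: "implements N [CX n ?b 1] (\<lambda>x. 1) (\<lambda>x. x(?b := (x ?b + x n) mod 3))"
    using Suc.prems(1) by (intro implements_CX) auto
  have "implements N ([CX n ?b 1] @ gs @ gs') (\<lambda>x. cis (f x)) (\<lambda>x. x)"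
  proof (rule implements_cong[OF implements_append[OF cx implements_append[OF gs gs']]], goal_cases)
    case (1 x)
    then show ?case by (simp add: cis_mult)
  next
    case (2 x)
    have "((x ?b + 2 * x n) mod 3 + x n) mod 3 = x ?b mod 3" by presburger
    then show ?case using 2 by (auto simp: trit_strings_def fun_eq_iff)
  qed
  moreover have "2 * cx_count ([CX n ?b 1] @ gs @ gs') + 3 = 3 ^ Suc ?b"
    using count count' by (simp add: cx_count_def)
  ultimately show ?case by blast
qed

section \<open>Diagonal unitaries as phase functions\<close>

text \<open>Diagonality reduces entry \<open>(i, i)\<close> of \<open>D * mat_adjoint D\<close> to
  the squared modulus of one entry.\<close>

lemma unitary_diagonal_entry:
  assumes "unitary_mat n D" "diagonal_mat D" "i < n"
  shows "cmod (D $$ (i, i)) = 1"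
proof -
  have D: "D \<in> carrier_mat n n" and "D * mat_adjoint D = 1\<^sub>m n"
    using assms(1) by (auto simp: unitary_mat_def)
  then have "1 = (D * mat_adjoint D) $$ (i, i)" using assms(3) by simp
  also have "\<dots> = (\<Sum>k = 0..<n. D $$ (i, k) * cnj (D $$ (i, k)))"
    using D assms(3) by (auto simp: scalar_prod_def mat_adjoint_def mat_of_rows_def intro!: sum.cong)
  also have "\<dots> = (\<Sum>k = 0..<n. if k = i then D $$ (i, i) * cnj (D $$ (i, i)) else 0)"
    using assms(2,3) D by (intro sum.cong) (auto simp: diagonal_mat_def)
  also have "\<dots> = D $$ (i, i) * cnj (D $$ (i, i))"
    using assms(3) by simp
  also have "\<dots> = complex_of_real ((cmod (D $$ (i, i)))\<^sup>2)"
    by (rule complex_norm_square[symmetric])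
  finally have "complex_of_real ((cmod (D $$ (i, i)))\<^sup>2) = 1" by (rule sym)
  then have "(cmod (D $$ (i, i)))\<^sup>2 = 1" by (simp only: of_real_eq_1_iff)
  then have "cmod (D $$ (i, i)) = 1 \<or> cmod (D $$ (i, i)) = - 1" by (simp only: power2_eq_1_iff)
  moreover have "cmod (D $$ (i, i)) \<ge> 0" by simp
  ultimately show ?thesis by linarith
qed

theorem proposition2:
  fixes N :: nat and D :: "complex mat"
  assumes "N \<ge> 1"
    and "unitary_mat (3 ^ N) D"
    and "diagonal_mat D"
  shows "\<exists>gs. (\<forall>g\<in>set gs. valid_gate N g) \<and> circuit_mat N gs = D \<and>
           real (cx_count gs) \<le> (3 ^ N - 3) / 2"
proof -
  \<comment> \<open>Diagonal entries have modulus 1, so \<open>cis\<close> of the argument recovers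
    them exactly.\<close>
  define f where "f x = Arg (D $$ (index_of N x, index_of N x))" for x
  obtain n where n: "N = Suc n" using assms(1) by (cases N) auto
  have "depends_below (Suc n) f"
    by (auto simp: depends_below_def f_def index_of_def n)
  then obtain gs where gs: "implements N gs (\<lambda>x. cis (f x)) (\<lambda>x. x)"
    and count: "2 * cx_count gs + 3 = 3 ^ N"
    using implements_diagonal[of n N f] n by auto
  have D: "D \<in> carrier_mat (3 ^ N) (3 ^ N)" using assms(2) by (simp add: unitary_mat_def)
  have "monomial_mat N (\<lambda>x. cis (f x)) (\<lambda>x. x) = D"
  proof (rule eq_matI)
    fix i j assume "i < dim_row D" "j < dim_col D"
    then have ij: "i < 3 ^ N" "j < 3 ^ N" using D by auto
    have "trit i = trit j \<longleftrightarrow> i = j"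
      using trit_eq_iff[OF ij(1) trit_in_trit_strings[OF ij(2)]] ij by (simp add: index_of_trit)
    moreover have "cis (f (trit j)) = D $$ (j, j)"
    proof -
      have "cmod (D $$ (j, j)) = 1" by (rule unitary_diagonal_entry[OF assms(2,3) ij(2)])
      then have "D $$ (j, j) \<noteq> 0" and "cmod (D $$ (j, j)) = 1" by auto
      then show ?thesis
        using ij cis_Arg[of "D $$ (j, j)"] by (auto simp: f_def index_of_trit sgn_eq)
    qed
    ultimately show "monomial_mat N (\<lambda>x. cis (f x)) (\<lambda>x. x) $$ (i, j) = D $$ (i, j)"
      using ij assms(3) D by (auto simp: monomial_mat_def diagonal_mat_def)
  qed (use D in \<open>auto simp: monomial_mat_def\<close>)
  moreover have "real (cx_count gs) \<le> (3 ^ N - 3) / 2"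
  proof -
    have "real (2 * cx_count gs + 3) = 3 ^ N" unfolding count by simp
    then show ?thesis by simp
  qed
  ultimately show ?thesis using gs by (auto simp: implements_def)
qed

end
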